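(* Let $a\ge 0$, let $\hat p=[\hat x,\hat v]^T\in\mathbb{R}^n\times\mathbb{R}^n$, and let $t\mapsto p(t)=\hat p+tX^a_{\mathrm{hb}}(\hat p)$ be the trajectory of the zero-order hold dynamics $\dot p=X^a_{\mathrm{hb}}(\hat p)$, $p(0)=\hat p$. Then, for all $t\ge0$, $$\frac{d}{dt}V(p(t))+\frac{\sqrt{\mu}}{4}V(p(t))\le b^{\mathrm d}_{\mathrm{ET}}(\hat p,t;a)\le b^{\mathrm d}_{\mathrm{ST}}(\hat p,t;a).$$
   Context: Let $\mu,L,s>0$, and let $f:\mathbb{R}^n\to\mathbb{R}$ be continuously differentiable, $\mu$-strongly convex (i.e. $f(y)-f(x)\ge\langle\nabla f(x),y-x\rangle+\frac{\mu}{2}\|x-y\|^2$ for all $x,y$), with $L$-Lipschitz gradient; $x_*$ is its unique minimizer. Norms are Euclidean. Notation: $\sqrt{\mu_s}=1+\sqrt{\mu s}$, so $\mu_s=(1+\sqrt{\mu s})^2$. For $a\ge0$, $$X^a_{\mathrm{hb}}(x,v)=\begin{bmatrix} v\\ -2\sqrt{\mu}\,v-\sqrt{\mu_s}\,\nabla f(x+av)\end{bmatrix},$$ $$V(x,v)=\sqrt{\mu_s}\,(f(x)-f(x_* ))+\tfrac14\|v\|^2+\tfrac14\|v+2\sqrt{\mu}(x-x_* )\|^2 .$$ For $\hat p=[\hat x,\hat v]^T$ write $\hat g=\nabla f(\hat x+a\hat v)$ and define $$b^{\mathrm d}_{\mathrm{ET}}(\hat p,t;a)=A_{\mathrm{ET}}(\hat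 p,t;a)+B_{\mathrm{ET}}(\hat p,t;a)+C_{\mathrm{ET}}(\hat p;a),$$ $$b^{\mathrm d}_{\mathrm{ST}}(\hat p,t;a)=B^q_{\mathrm{ST}}(\hat p;a)t^2+(A_{\mathrm{ST}}(\hat p;a)+B^l_{\mathrm{ST}}(\hat p;a))t+C_{\mathrm{ST}}(\hat p;a),$$ where $$A_{\mathrm{ET}}(\hat p,t;a)=2\mu t\|\hat v\|^2+\sqrt{\mu_s}\big(\langle\nabla f(\hat x+t\hat v)-\nabla f(\hat x),\hat v\rangle+2t\sqrt\mu\langle\hat g,\hat v\rangle+t\sqrt{\mu_s}\|\hat g\|^2\big),$$ $$B_{\mathrm{ET}}(\hat p,t;a)=\frac{\sqrt\mu t^2}{16}\|2\sqrt\mu\hat v+\sqrt{\mu_s}\hat g\|^2-\frac{t\mu}{4}\|\hat v\|^2+\frac{\sqrt\mu\sqrt{\mu_s}}{4}\Big(f(\hat x+t\hat v)-f(\hat x)-t\langle\hat v,\hat g\rangle+\frac{t^2\sqrt{\mu_s}}{4}\|\hat g\|^2-\frac{t\sqrt\mu}{L}\|\hat g\|^2+t\sqrt\mu\langle a\hat v,\hat g\rangle\Big),$$ $$C_{\mathrm{ET}}(\hat p;a)=-\frac{13\sqrt\mu}{16}\|\hat v\|^2-\frac{\mu^2\sqrt s}{2}\frac{\|\nabla f(\hat x)\|^2}{L^2}+\sqrt{\mu_s}\Big(-\frac{3\sqrt\mu}{8L}\|\nabla f(\hat x)\|^2+\sqrt\mu(f(\hat x)-f(\hat x+a\hat v))+\sqrt\mu\|\nabla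 f(\hat x)\|\|a\hat v\|-\frac{\mu^{3/2}}{2}\|a\hat v\|^2-\langle\hat g-\nabla f(\hat x),\hat v\rangle+\sqrt\mu\langle\hat g,a\hat v\rangle\Big),$$ $$A_{\mathrm{ST}}(\hat p;a)=2\mu\|\hat v\|^2+\sqrt{\mu_s}\big(L\|\hat v\|^2+2\sqrt\mu\langle\hat g,\hat v\rangle+\sqrt{\mu_s}\|\hat g\|^2\big),$$ $$B^l_{\mathrm{ST}}(\hat p;a)=\frac{\sqrt\mu}{4}\Big(-\sqrt\mu\|\hat v\|^2+\sqrt{\mu_s}\big(\langle\nabla f(\hat x)-\hat g,\hat v\rangle-\frac{\sqrt\mu}{L}\|\hat g\|^2+\sqrt\mu\langle a\hat v,\hat g\rangle\big)\Big),$$ $$B^q_{\mathrm{ST}}(\hat p;a)=\frac{\sqrt\mu}{16}\|2\sqrt\mu\hat v+\sqrt{\mu_s}\hat g\|^2+\frac{\sqrt\mu\sqrt{\mu_s}}{4}\Big(\frac L2\|\hat v\|^2+\frac{\sqrt{\mu_s}}{4}\|\hat g\|^2\Big),$$ $$C_{\mathrm{ST}}(\hat p;a)=C_{\mathrm{ET}}(\hat p;a).$$ *)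

theory Defs
  imports "HOL-Analysis.Analysis"
begin

definition gradient :: "('a::real_inner \<Rightarrow> real) \<Rightarrow> 'a \<Rightarrow> 'a" where
  "gradient f x = (THE g. GDERIV f x :> g)"

lemma gderiv_gradient:
  fixes f :: "'a::euclidean_space \<Rightarrow> real"
  assumes "f differentiable (at x)"
  shows "GDERIV f x :> gradient f x"
proof -
  from assms obtain D where D: "(f has_derivative D) (at x)"
    unfolding differentiable_def by blast
  then interpret linear D by (rule has_derivative_linear)
  define g where "g = (\<Sum>b\<in>Basis. D b *\<^sub>R b)"
  have "D h = h \<bullet> g" for h
  proof -
    have "D h = D (\<Sum>b\<in>Basis. (h \<bullet> b) *\<^sub>R b)" by (simp only: euclidean_representation)
    also have "\<dots> = (\<Sum>b\<in>Basis. (h \<bullet> b) * D b)" by (simp add: sum scaleR)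
    also have "\<dots> = h \<bullet> g"
      unfolding g_def by (simp add: inner_sum_right mult.commute)
    finally show ?thesis .
  qed
  then have "D = (\<lambda>h. h \<bullet> g)" by (rule ext)
  with D have g: "GDERIV f x :> g"
    unfolding gderiv_def by simp
  have "g' = g" if "GDERIV f x :> g'" for g'
  proof -
    have "(\<lambda>h. h \<bullet> g') = (\<lambda>h. h \<bullet> g)"
      using that g unfolding gderiv_def by (rule has_derivative_unique)
    then have "\<forall>h. h \<bullet> g' = h \<bullet> g" by (simp add: fun_eq_iff)
    then show ?thesis by (simp only: vector_eq_ldot)
  qed
  with g show ?thesis unfolding gradient_def by (rule theI)
qed

definition continuously_differentiable :: "('a::euclidean_space \<Rightarrow> real) \<Rightarrow> bool" where
  "continuously_differentiable f \<longleftrightarrow>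
     (\<forall>x. f differentiable (at x)) \<and> continuous_on UNIV (gradient f)"

definition strongly_convex :: "real \<Rightarrow> ('a::euclidean_space \<Rightarrow> real) \<Rightarrow> bool" where
  "strongly_convex \<mu> f \<longleftrightarrow>
     (\<forall>x y. f y - f x \<ge> gradient f x \<bullet> (y - x) + \<mu> / 2 * (norm (x - y))\<^sup>2)"

definition unique_minimizer :: "('a \<Rightarrow> real) \<Rightarrow> 'a \<Rightarrow> bool" where
  "unique_minimizer f x \<longleftrightarrow> (\<forall>y. y \<noteq> x \<longrightarrow> f x < f y)"

text \<open>This is the square root of \<open>\<mu>\<^sub>s = (1 + sqrt (\<mu> * s))\<^sup>2\<close>.\<close>

definition sqrt_mus :: "real \<Rightarrow> real \<Rightarrow> real" where
  "sqrt_mus \<mu> s = 1 + sqrt (\<mu> * s)"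

fun X_hb :: "('a::euclidean_space \<Rightarrow> real) \<Rightarrow> real \<Rightarrow> real \<Rightarrow> real \<Rightarrow> 'a \<times> 'a \<Rightarrow> 'a \<times> 'a" where
  "X_hb f \<mu> s a (x, v) =
     (v, - (2 * sqrt \<mu>) *\<^sub>R v - sqrt_mus \<mu> s *\<^sub>R gradient f (x + a *\<^sub>R v))"

fun V :: "('a::euclidean_space \<Rightarrow> real) \<Rightarrow> 'a \<Rightarrow> real \<Rightarrow> real \<Rightarrow> 'a \<times> 'a \<Rightarrow> real" where
  "V f xstar \<mu> s (x, v) =
     sqrt_mus \<mu> s * (f x - f xstar) + 1/4 * (norm v)\<^sup>2
     + 1/4 * (norm (v + (2 * sqrt \<mu>) *\<^sub>R (x - xstar)))\<^sup>2"

definition zoh_trajectory ::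
  "('a::euclidean_space \<Rightarrow> real) \<Rightarrow> real \<Rightarrow> real \<Rightarrow> real \<Rightarrow> 'a \<times> 'a \<Rightarrow> real \<Rightarrow> 'a \<times> 'a" where
  "zoh_trajectory f \<mu> s a p0 t = p0 + t *\<^sub>R X_hb f \<mu> s a p0"

lemma zoh_trajectory_0: "zoh_trajectory f \<mu> s a p0 0 = p0"
  by (simp add: zoh_trajectory_def)

text \<open>In the zero-order hold dynamics the field is frozen at the initial point \<open>p0\<close>.\<close>

lemma zoh_trajectory_ode:
  "(zoh_trajectory f \<mu> s a p0 has_vector_derivative X_hb f \<mu> s a p0) (at t)"
  unfolding zoh_trajectory_def by (auto intro!: derivative_eq_intros)

fun A_ET :: "('a::euclidean_space \<Rightarrow> real) \<Rightarrow> real \<Rightarrow> real \<Rightarrow> 'a \<times> 'a \<Rightarrow> real \<Rightarrow> real \<Rightarrow> real" where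
  "A_ET f \<mu> s (x, v) t a =
     (let g = gradient f (x + a *\<^sub>R v) in
      2 * \<mu> * t * (norm v)\<^sup>2
      + sqrt_mus \<mu> s *
          ((gradient f (x + t *\<^sub>R v) - gradient f x) \<bullet> v
           + 2 * t * sqrt \<mu> * (g \<bullet> v)
           + t * sqrt_mus \<mu> s * (norm g)\<^sup>2))"

fun B_ET :: "('a::euclidean_space \<Rightarrow> real) \<Rightarrow> real \<Rightarrow> real \<Rightarrow> real \<Rightarrow> 'a \<times> 'a \<Rightarrow> real \<Rightarrow> real \<Rightarrow> real" where
  "B_ET f \<mu> L s (x, v) t a =
     (let g = gradient f (x + a *\<^sub>R v) in
      sqrt \<mu> * t\<^sup>2 / 16 * (norm ((2 * sqrt \<mu>) *\<^sub>R v + sqrt_mus \<mu> s *\<^sub>R g))\<^sup>2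
      - t * \<mu> / 4 * (norm v)\<^sup>2
      + sqrt \<mu> * sqrt_mus \<mu> s / 4 *
          (f (x + t *\<^sub>R v) - f x - t * (v \<bullet> g)
           + t\<^sup>2 * sqrt_mus \<mu> s / 4 * (norm g)\<^sup>2
           - t * sqrt \<mu> / L * (norm g)\<^sup>2
           + t * sqrt \<mu> * ((a *\<^sub>R v) \<bullet> g)))"

fun C_ET :: "('a::euclidean_space \<Rightarrow> real) \<Rightarrow> real \<Rightarrow> real \<Rightarrow> real \<Rightarrow> 'a \<times> 'a \<Rightarrow> real \<Rightarrow> real" where
  "C_ET f \<mu> L s (x, v) a =
     (let g = gradient f (x + a *\<^sub>R v) in
      - (13 * sqrt \<mu> / 16) * (norm v)\<^sup>2
      - \<mu>\<^sup>2 * sqrt s / 2 * ((norm (gradient f x))\<^sup>2 / L\<^sup>2)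
      + sqrt_mus \<mu> s *
          (- (3 * sqrt \<mu> / (8 * L)) * (norm (gradient f x))\<^sup>2
           + sqrt \<mu> * (f x - f (x + a *\<^sub>R v))
           + sqrt \<mu> * norm (gradient f x) * norm (a *\<^sub>R v)
           - \<mu> powr (3/2) / 2 * (norm (a *\<^sub>R v))\<^sup>2
           - (g - gradient f x) \<bullet> v
           + sqrt \<mu> * (g \<bullet> (a *\<^sub>R v))))"

definition b_ET :: "('a::euclidean_space \<Rightarrow> real) \<Rightarrow> real \<Rightarrow> real \<Rightarrow> real \<Rightarrow> 'a \<times> 'a \<Rightarrow> real \<Rightarrow> real \<Rightarrow> real" where
  "b_ET f \<mu> L s p t a = A_ET f \<mu> s p t a + B_ET f \<mu> L s p t a + C_ET f \<mu> L s p a"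

fun A_ST :: "('a::euclidean_space \<Rightarrow> real) \<Rightarrow> real \<Rightarrow> real \<Rightarrow> real \<Rightarrow> 'a \<times> 'a \<Rightarrow> real \<Rightarrow> real" where
  "A_ST f \<mu> L s (x, v) a =
     (let g = gradient f (x + a *\<^sub>R v) in
      2 * \<mu> * (norm v)\<^sup>2
      + sqrt_mus \<mu> s *
          (L * (norm v)\<^sup>2 + 2 * sqrt \<mu> * (g \<bullet> v) + sqrt_mus \<mu> s * (norm g)\<^sup>2))"

fun Bl_ST :: "('a::euclidean_space \<Rightarrow> real) \<Rightarrow> real \<Rightarrow> real \<Rightarrow> real \<Rightarrow> 'a \<times> 'a \<Rightarrow> real \<Rightarrow> real" where
  "Bl_ST f \<mu> L s (x, v) a =
     (let g = gradient f (x + a *\<^sub>R v) in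
      sqrt \<mu> / 4 *
        (- sqrt \<mu> * (norm v)\<^sup>2
         + sqrt_mus \<mu> s *
             ((gradient f x - g) \<bullet> v - sqrt \<mu> / L * (norm g)\<^sup>2
              + sqrt \<mu> * ((a *\<^sub>R v) \<bullet> g))))"

fun Bq_ST :: "('a::euclidean_space \<Rightarrow> real) \<Rightarrow> real \<Rightarrow> real \<Rightarrow> real \<Rightarrow> 'a \<times> 'a \<Rightarrow> real \<Rightarrow> real" where
  "Bq_ST f \<mu> L s (x, v) a =
     (let g = gradient f (x + a *\<^sub>R v) in
      sqrt \<mu> / 16 * (norm ((2 * sqrt \<mu>) *\<^sub>R v + sqrt_mus \<mu> s *\<^sub>R g))\<^sup>2
      + sqrt \<mu> * sqrt_mus \<mu> s / 4 *
          (L / 2 * (norm v)\<^sup>2 + sqrt_mus \<mu> s / 4 * (norm g)\<^sup>2))"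

definition C_ST :: "('a::euclidean_space \<Rightarrow> real) \<Rightarrow> real \<Rightarrow> real \<Rightarrow> real \<Rightarrow> 'a \<times> 'a \<Rightarrow> real \<Rightarrow> real" where
  "C_ST f \<mu> L s p a = C_ET f \<mu> L s p a"

definition b_ST :: "('a::euclidean_space \<Rightarrow> real) \<Rightarrow> real \<Rightarrow> real \<Rightarrow> real \<Rightarrow> 'a \<times> 'a \<Rightarrow> real \<Rightarrow> real \<Rightarrow> real" where
  "b_ST f \<mu> L s p t a =
     Bq_ST f \<mu> L s p a * t\<^sup>2 + (A_ST f \<mu> L s p a + Bl_ST f \<mu> L s p a) * t + C_ST f \<mu> L s p a"

end

theory Submission imports Defs
begin

text \<open>Write \<open>u = x - xstar\<close> and \<open>y = x + a v\<close>, and let \<open>g\<close> and \<open>G\<close> be the gradients at \<open>y\<close> and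
  \<open>x\<close>. Along the trajectory \<open>V\<close> is explicit in the time \<open>t\<close> apart from \<open>f (x + t v)\<close>. The terms
  linear in \<open>t\<close> are bounded by co-coercivity of the gradient at \<open>y\<close> and \<open>xstar\<close>. In the constant
  terms, strong convexity at \<open>y\<close> bounds \<open>-\<langle>y - xstar, g\<rangle>\<close>, the mixed norm is at most
  \<open>2 |v|\<^sup>2 + 8 \<mu> |u|\<^sup>2\<close>, and what remains follows from \<open>\<mu> |u| \<le> |G| \<le> L |u|\<close> and
  \<open>|G|\<^sup>2 \<le> 2 L (f x - f xstar)\<close>. The second inequality is the descent lemma together with the
  Lipschitz bound.\<close>

section \<open>Inequalities for gradients of smooth convex functions\<close>

lemma has_real_derivative_along_line:
  fixes f :: "'a::euclidean_space \<Rightarrow> real"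
  assumes "f differentiable (at (x + t *\<^sub>R v))"
  shows "((\<lambda>\<tau>. f (x + \<tau> *\<^sub>R v)) has_real_derivative (gradient f (x + t *\<^sub>R v) \<bullet> v)) (at t)"
proof -
  have f': "(f has_derivative (\<lambda>h. h \<bullet> gradient f (x + t *\<^sub>R v))) (at (x + t *\<^sub>R v))"
    using gderiv_gradient[OF assms] unfolding gderiv_def .
  have line': "((\<lambda>\<tau>. x + \<tau> *\<^sub>R v) has_derivative (\<lambda>h. h *\<^sub>R v)) (at t)"
    by (auto intro!: derivative_eq_intros)
  have "((\<lambda>\<tau>. f (x + \<tau> *\<^sub>R v)) has_derivative (\<lambda>h. (h *\<^sub>R v) \<bullet> gradient f (x + t *\<^sub>R v))) (at t)"
    using has_derivative_compose[OF line' f'] .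
  moreover have "(\<lambda>h. (h *\<^sub>R v) \<bullet> gradient f (x + t *\<^sub>R v)) = (*) (gradient f (x + t *\<^sub>R v) \<bullet> v)"
    by (auto simp: inner_commute)
  ultimately show ?thesis unfolding has_field_derivative_def by simp
qed

lemma lipschitz_gradient_inner_le:
  fixes f :: "'a::euclidean_space \<Rightarrow> real"
  assumes "L-lipschitz_on UNIV (gradient f)" and "t \<ge> 0"
  shows "(gradient f (x + t *\<^sub>R v) - gradient f x) \<bullet> v \<le> L * t * (norm v)\<^sup>2"
proof -
  have "(gradient f (x + t *\<^sub>R v) - gradient f x) \<bullet> v
      \<le> norm (gradient f (x + t *\<^sub>R v) - gradient f x) * norm v"
    by (rule norm_cauchy_schwarz)
  also have "\<dots> \<le> (L * norm (t *\<^sub>R v)) * norm v"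
    using lipschitz_onD[OF assms(1), of "x + t *\<^sub>R v" x]
    by (intro mult_right_mono) (auto simp: dist_norm)
  also have "\<dots> = L * t * (norm v)\<^sup>2"
    using assms(2) by (simp add: power2_eq_square)
  finally show ?thesis .
qed

text \<open>The defect \<open>\<phi>\<close> between \<open>f\<close> and its quadratic upper model,
  followed from \<open>x\<close> towards \<open>y\<close>, has nonpositive derivative by the
  Lipschitz bound, so it does not increase from time 0 to time 1.\<close>

lemma descent_lemma:
  fixes f :: "'a::euclidean_space \<Rightarrow> real"
  assumes "\<And>x. f differentiable (at x)" and lip: "L-lipschitz_on UNIV (gradient f)"
  shows "f y \<le> f x + gradient f x \<bullet> (y - x) + L / 2 * (norm (y - x))\<^sup>2"
proof -
  define v where "v = y - x"
  define \<phi> where "\<phi> \<tau> = f (x + \<tau> *\<^sub>R v) - \<tau> * (gradient f x \<bullet> v) - L / 2 * \<tau>\<^sup>2 * (norm v)\<^sup>2" for \<tau>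
  have decr: "\<exists>d. (\<phi> has_real_derivative d) (at \<tau>) \<and> d \<le> 0" if "0 \<le> \<tau>" for \<tau>
  proof (intro exI conjI)
    show "(\<phi> has_real_derivative (gradient f (x + \<tau> *\<^sub>R v) \<bullet> v - gradient f x \<bullet> v
        - L * \<tau> * (norm v)\<^sup>2)) (at \<tau>)"
      unfolding \<phi>_def
      by (auto intro!: derivative_eq_intros has_real_derivative_along_line assms)
    show "gradient f (x + \<tau> *\<^sub>R v) \<bullet> v - gradient f x \<bullet> v - L * \<tau> * (norm v)\<^sup>2 \<le> 0"
      using lipschitz_gradient_inner_le[OF lip that, of x v] by (simp add: inner_diff_left)
  qed
  have "\<phi> 1 \<le> \<phi> 0"
    by (rule DERIV_nonpos_imp_nonincreasing[OF zero_le_one]) (rule decr)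
  then show ?thesis by (simp add: \<phi>_def v_def)
qed

text \<open>Serves twice: symmetrised it gives co-coercivity, and with \<open>x\<close> critical it
  bounds the squared gradient norm at \<open>y\<close> by \<open>2 * L\<close> times the function
  gap.\<close>

lemma convex_smooth_gap:
  fixes f :: "'a::euclidean_space \<Rightarrow> real"
  assumes "\<And>x. f differentiable (at x)" and lip: "L-lipschitz_on UNIV (gradient f)" and "L > 0"
    and convex: "\<And>x y. gradient f x \<bullet> (y - x) \<le> f y - f x"
  shows "f x + gradient f x \<bullet> (y - x) + (norm (gradient f y - gradient f x))\<^sup>2 / (2 * L) \<le> f y"
proof -
  define d where "d = gradient f y - gradient f x"
  \<comment> \<open>a gradient step from \<open>y\<close> for the convex function \<open>\<lambda>z. f z - gradient f x \<bullet> z\<close>,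
    which is minimal at \<open>x\<close>\<close>
  define z where "z = y - (1 / L) *\<^sub>R d"
  have "gradient f x \<bullet> (z - x) \<le> f z - f x" by (rule convex)
  moreover have "f z \<le> f y + gradient f y \<bullet> (z - y) + L / 2 * (norm (z - y))\<^sup>2"
    by (rule descent_lemma[OF assms(1) lip])
  moreover have "L / 2 * (norm (z - y))\<^sup>2 = (norm d)\<^sup>2 / (2 * L)"
    using \<open>L > 0\<close> by (simp add: z_def power2_eq_square)
  moreover have "gradient f x \<bullet> (z - x) = gradient f x \<bullet> (y - x) - (gradient f x \<bullet> d) / L"
    "gradient f y \<bullet> (z - y) = - (gradient f y \<bullet> d) / L"
    by (simp_all add: z_def inner_diff_right)
  moreover have "(gradient f y \<bullet> d) / L - (gradient f x \<bullet> d) / L = (norm d)\<^sup>2 / L"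
    by (simp add: d_def power2_norm_eq_inner inner_diff_left diff_divide_distrib)
  moreover have "(norm d)\<^sup>2 / L = 2 * ((norm d)\<^sup>2 / (2 * L))" by simp
  ultimately show ?thesis unfolding d_def by linarith
qed

text \<open>Adding the gap inequality to its copy with \<open>x\<close> and \<open>y\<close> swapped
  cancels the function values, and the two halves \<open>1 / (2 * L)\<close> add up.\<close>

lemma gradient_cocoercive:
  fixes f :: "'a::euclidean_space \<Rightarrow> real"
  assumes "\<And>x. f differentiable (at x)" "L-lipschitz_on UNIV (gradient f)" "L > 0"
    and "\<And>x y. gradient f x \<bullet> (y - x) \<le> f y - f x"
  shows "(norm (gradient f y - gradient f x))\<^sup>2 / L \<le> (gradient f y - gradient f x) \<bullet> (y - x)"
proof -
  have "(gradient f y - gradient f x) \<bullet> (y - x)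
      = - (gradient f x \<bullet> (y - x)) - gradient f y \<bullet> (x - y)"
    by (simp add: inner_diff_left inner_diff_right)
  moreover have "d / L = d / (2 * L) + d / (2 * L)" for d by (simp add: field_simps)
  ultimately show ?thesis
    using convex_smooth_gap[OF assms, of x y] convex_smooth_gap[OF assms, of y x]
    unfolding norm_minus_commute[of "gradient f x"] by smt
qed

lemma gradient_eq_0_at_minimizer:
  fixes f :: "'a::euclidean_space \<Rightarrow> real"
  assumes "f differentiable (at x)" and "\<And>y. f x \<le> f y"
  shows "gradient f x = 0"
proof -
  have "(f has_derivative (\<lambda>h. h \<bullet> gradient f x)) (at x)"
    using gderiv_gradient[OF assms(1)] unfolding gderiv_def .
  then have "(\<lambda>h. h \<bullet> gradient f x) = (\<lambda>h. 0)"
    by (rule has_derivative_local_min) (simp add: assms(2))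
  then have "gradient f x \<bullet> gradient f x = 0" by meson
  then show ?thesis by simp
qed

lemma strongly_convex_gradient_ineq:
  assumes "strongly_convex \<mu> f" and "\<mu> \<ge> 0"
  shows "gradient f x \<bullet> (y - x) \<le> f y - f x"
proof -
  have "gradient f x \<bullet> (y - x) + \<mu> / 2 * (norm (x - y))\<^sup>2 \<le> f y - f x"
    using assms(1) by (auto simp: strongly_convex_def)
  moreover have "0 \<le> \<mu> / 2 * (norm (x - y))\<^sup>2" using assms(2) by simp
  ultimately show ?thesis by linarith
qed

section \<open>The Lyapunov function along the zero-order hold trajectory\<close>

lemma norm_add_power2:
  fixes b c :: "'a::real_inner"
  shows "(norm (b + c))\<^sup>2 = (norm b)\<^sup>2 + 2 * (b \<bullet> c) + (norm c)\<^sup>2"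
  unfolding power2_norm_eq_inner by (simp add: inner_add_left inner_add_right inner_commute)

lemma V_zoh_trajectory:
  shows "V f xstar \<mu> s (zoh_trajectory f \<mu> s a (x, v) t) =
    (let r = sqrt \<mu>; q = sqrt_mus \<mu> s; g = gradient f (x + a *\<^sub>R v); u = x - xstar in
      q * (f (x + t *\<^sub>R v) - f xstar)
      + 1/4 * ((norm v)\<^sup>2 - t * (4 * r * (norm v)\<^sup>2 + 2 * q * (g \<bullet> v))
          + t\<^sup>2 * (norm ((2 * r) *\<^sub>R v + q *\<^sub>R g))\<^sup>2)
      + 1/4 * ((norm (v + (2 * r) *\<^sub>R u))\<^sup>2 - t * (2 * q * (g \<bullet> v) + 4 * r * q * (g \<bullet> u))
          + t\<^sup>2 * (q\<^sup>2 * (norm g)\<^sup>2)))"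
proof -
  define r q g u where "r = sqrt \<mu>" and "q = sqrt_mus \<mu> s" and "g = gradient f (x + a *\<^sub>R v)"
    and "u = x - xstar"
  note defs = r_def[symmetric] q_def[symmetric] g_def[symmetric] u_def[symmetric]
  have velocity: "v + t *\<^sub>R (- (2 * r) *\<^sub>R v - q *\<^sub>R g) = v - t *\<^sub>R ((2 * r) *\<^sub>R v + q *\<^sub>R g)"
    by (simp add: algebra_simps)
  \<comment> \<open>The damping in the velocity cancels the drift of the position, so only the
    gradient term moves with \<open>t\<close>.\<close>
  have mixed: "v - t *\<^sub>R ((2 * r) *\<^sub>R v + q *\<^sub>R g) + (2 * r) *\<^sub>R (x + t *\<^sub>R v - xstar)
      = (v + (2 * r) *\<^sub>R u) - t *\<^sub>R (q *\<^sub>R g)"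
    by (simp add: u_def algebra_simps)
  have norm_step: "(norm (b - t *\<^sub>R c))\<^sup>2 = (norm b)\<^sup>2 - t * (2 * (c \<bullet> b)) + t\<^sup>2 * (norm c)\<^sup>2"
    for b c :: 'a
    using norm_add_power2[of b "- t *\<^sub>R c"]
    by (simp add: power_mult_distrib inner_commute)
  have "((2 * r) *\<^sub>R v + q *\<^sub>R g) \<bullet> v = 2 * r * (norm v)\<^sup>2 + q * (g \<bullet> v)"
    by (simp add: inner_add_left power2_norm_eq_inner)
  moreover have "(q *\<^sub>R g) \<bullet> (v + (2 * r) *\<^sub>R u) = q * (g \<bullet> v) + 2 * r * q * (g \<bullet> u)"
    by (simp add: inner_add_right algebra_simps)
  moreover have "(norm (q *\<^sub>R g))\<^sup>2 = q\<^sup>2 * (norm g)\<^sup>2"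
    by (simp add: power_mult_distrib)
  moreover have "zoh_trajectory f \<mu> s a (x, v) t
      = (x + t *\<^sub>R v, v - t *\<^sub>R ((2 * r) *\<^sub>R v + q *\<^sub>R g))"
    unfolding zoh_trajectory_def X_hb.simps defs scaleR_Pair add_Pair velocity ..
  ultimately show ?thesis
    unfolding Let_def defs by (simp only: V.simps defs mixed norm_step) (simp add: algebra_simps)
qed

text \<open>Isolates what \<open>A_ET\<close> and \<open>B_ET\<close> leave over: terms free of
  \<open>t\<close>, to be absorbed by \<open>C_ET\<close>, and one term linear in \<open>t\<close>
  whose sign is decided by co-coercivity.\<close>

lemma V_decay_expansion:
  fixes f :: "'a::euclidean_space \<Rightarrow> real" and x v xstar :: 'a and \<mu> s a :: real
  defines "r \<equiv> sqrt \<mu>" and "q \<equiv> sqrt_mus \<mu> s" and "g \<equiv> gradient f (x + a *\<^sub>R v)"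
    and "u \<equiv> x - xstar"
  assumes "\<mu> > 0" and diff: "\<And>x. f differentiable (at x)"
  shows "((\<lambda>\<tau>. V f xstar \<mu> s (zoh_trajectory f \<mu> s a (x, v) \<tau>)) has_real_derivative
      (A_ET f \<mu> s (x, v) t a - q * ((g - gradient f x) \<bullet> v) - r * (norm v)\<^sup>2 - q * r * (g \<bullet> u)))
      (at t)"
    and "r / 4 * V f xstar \<mu> s (zoh_trajectory f \<mu> s a (x, v) t) =
      B_ET f \<mu> L s (x, v) t a
      + q * r / 4 * (f x - f xstar) + r / 16 * (norm v)\<^sup>2 + r / 16 * (norm (v + (2 * r) *\<^sub>R u))\<^sup>2
      - t * r\<^sup>2 * q / 4 * (g \<bullet> (x + a *\<^sub>R v - xstar) - (norm g)\<^sup>2 / L)"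
proof -
  note defs = r_def[symmetric] q_def[symmetric] g_def[symmetric] u_def[symmetric]
  have mu: "\<mu> = r\<^sup>2" using \<open>\<mu> > 0\<close> by (simp add: r_def)
  have V: "V f xstar \<mu> s (zoh_trajectory f \<mu> s a (x, v) \<tau>) =
      q * (f (x + \<tau> *\<^sub>R v) - f xstar)
      + 1/4 * ((norm v)\<^sup>2 - \<tau> * (4 * r * (norm v)\<^sup>2 + 2 * q * (g \<bullet> v))
          + \<tau>\<^sup>2 * (norm ((2 * r) *\<^sub>R v + q *\<^sub>R g))\<^sup>2)
      + 1/4 * ((norm (v + (2 * r) *\<^sub>R u))\<^sup>2 - \<tau> * (2 * q * (g \<bullet> v) + 4 * r * q * (g \<bullet> u))
          + \<tau>\<^sup>2 * (q\<^sup>2 * (norm g)\<^sup>2))" for \<tau>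
    unfolding V_zoh_trajectory Let_def defs ..
  \<comment> \<open>\<open>A_ET\<close> displays this square expanded while \<open>B_ET\<close>
    keeps the norm, so \<open>w\<close> is unfolded only for the derivative.\<close>
  have w: "(norm ((2 * r) *\<^sub>R v + q *\<^sub>R g))\<^sup>2
      = 4 * r\<^sup>2 * (norm v)\<^sup>2 + 4 * r * q * (g \<bullet> v) + q\<^sup>2 * (norm g)\<^sup>2"
    unfolding norm_add_power2 by (simp add: power_mult_distrib inner_commute)
  show "((\<lambda>\<tau>. V f xstar \<mu> s (zoh_trajectory f \<mu> s a (x, v) \<tau>)) has_real_derivative
      (A_ET f \<mu> s (x, v) t a - q * ((g - gradient f x) \<bullet> v) - r * (norm v)\<^sup>2 - q * r * (g \<bullet> u)))
      (at t)"
    unfolding V w A_ET.simps Let_def defs inner_diff_left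
    by (auto intro!: derivative_eq_intros has_real_derivative_along_line diff)
      (simp add: mu power2_eq_square field_simps)
  \<comment> \<open>Co-coercivity is available at the point where \<open>g\<close> is evaluated.
    Moving the base point there from \<open>x\<close> produces the term
    \<open>(a *\<^sub>R v) \<bullet> g\<close> of \<open>B_ET\<close>.\<close>
  have shift: "g \<bullet> (x + a *\<^sub>R v - xstar) = g \<bullet> u + (a *\<^sub>R v) \<bullet> g"
    by (simp add: u_def inner_diff_right inner_add_right inner_commute algebra_simps)
  show "r / 4 * V f xstar \<mu> s (zoh_trajectory f \<mu> s a (x, v) t) =
      B_ET f \<mu> L s (x, v) t a
      + q * r / 4 * (f x - f xstar) + r / 16 * (norm v)\<^sup>2 + r / 16 * (norm (v + (2 * r) *\<^sub>R u))\<^sup>2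
      - t * r\<^sup>2 * q / 4 * (g \<bullet> (x + a *\<^sub>R v - xstar) - (norm g)\<^sup>2 / L)"
    unfolding V B_ET.simps Let_def defs inner_commute[of v g] shift
    by (simp add: mu power2_eq_square add_divide_distrib diff_divide_distrib algebra_simps)
qed

text \<open>\<open>C_ET\<close> does not mention \<open>xstar\<close>, so each occurrence of
  \<open>u\<close> and of \<open>f xstar\<close> has to cancel or be traded for the gradient at
  \<open>x\<close>.\<close>

lemma constant_terms_le_C_ET:
  fixes f :: "'a::euclidean_space \<Rightarrow> real" and x v xstar :: 'a and \<mu> s a :: real
  defines "r \<equiv> sqrt \<mu>" and "q \<equiv> sqrt_mus \<mu> s" and "g \<equiv> gradient f (x + a *\<^sub>R v)"
    and "u \<equiv> x - xstar"
  assumes "\<mu> > 0" "L > 0" "s > 0"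
    and diff: "\<And>x. f differentiable (at x)"
    and sc: "strongly_convex \<mu> f"
    and lip: "L-lipschitz_on UNIV (gradient f)"
    and crit: "gradient f xstar = 0"
  shows "- q * ((g - gradient f x) \<bullet> v) - r * (norm v)\<^sup>2 - q * r * (g \<bullet> u)
      + q * r / 4 * (f x - f xstar) + r / 16 * (norm v)\<^sup>2 + r / 16 * (norm (v + (2 * r) *\<^sub>R u))\<^sup>2
      \<le> C_ET f \<mu> L s (x, v) a"
proof -
  note defs = r_def[symmetric] q_def[symmetric] g_def[symmetric] u_def[symmetric]
  define G where "G = gradient f x"
  define y where "y = x + a *\<^sub>R v"
  have sc': "gradient f x \<bullet> (y - x) + \<mu> / 2 * (norm (x - y))\<^sup>2 \<le> f y - f x" for x y
    using sc by (auto simp: strongly_convex_def)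
  have r: "r > 0" and mu: "\<mu> = r\<^sup>2" using \<open>\<mu> > 0\<close> by (simp_all add: r_def)
  have q: "q = 1 + r * sqrt s" by (simp add: q_def sqrt_mus_def r_def real_sqrt_mult)
  have qpos: "q > 0" using r \<open>s > 0\<close> by (simp add: q add_pos_pos)
  note convex = strongly_convex_gradient_ineq[OF sc less_imp_le[OF \<open>\<mu> > 0\<close>]]
  have gap: "(norm G)\<^sup>2 / (2 * L) \<le> f x - f xstar"
    using convex_smooth_gap[OF diff lip \<open>L > 0\<close> convex, of xstar x] crit by (simp add: G_def)
  have G_le: "norm G \<le> L * norm u"
    using lipschitz_onD[OF lip, of x xstar] crit by (simp add: dist_norm G_def u_def)
  \<comment> \<open>Strong convexity in both directions between \<open>x\<close> and
    \<open>xstar\<close> sums to strong monotonicity; Cauchy-Schwarz then allows division by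
    \<open>norm u\<close>.\<close>
  have G_ge: "\<mu> * norm u \<le> norm G"
  proof -
    have "\<mu> * (norm u)\<^sup>2 \<le> G \<bullet> u"
      using sc'[of x xstar] sc'[of xstar x] crit
      by (simp add: G_def u_def norm_minus_commute inner_diff_right)
    also have "\<dots> \<le> norm G * norm u" by (rule norm_cauchy_schwarz)
    finally show ?thesis
      by (cases "u = 0") (auto simp: power2_eq_square)
  qed
  have at_y: "- (g \<bullet> u) \<le> g \<bullet> (a *\<^sub>R v) + f xstar - f y - \<mu> / 2 * (norm (u + a *\<^sub>R v))\<^sup>2"
    using sc'[of y xstar]
    by (simp add: g_def y_def u_def inner_diff_right inner_add_right algebra_simps)
  have young: "(norm (v + (2 * r) *\<^sub>R u))\<^sup>2 \<le> 2 * (norm v)\<^sup>2 + 8 * \<mu> * (norm u)\<^sup>2"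
  proof -
    \<comment> \<open>Expanding this square bounds the cross term
      \<open>4 * r * (v \<bullet> u)\<close> by the two pure squares.\<close>
    have "0 \<le> (norm (v + (- (2 * r)) *\<^sub>R u))\<^sup>2" by simp
    then show ?thesis
      unfolding norm_add_power2 by (simp add: mu power_mult_distrib)
  qed
  have sq: "(norm (u + a *\<^sub>R v))\<^sup>2 \<ge> (norm u)\<^sup>2 - 2 * (norm u * norm (a *\<^sub>R v)) + (norm (a *\<^sub>R v))\<^sup>2"
    using Cauchy_Schwarz_ineq2[of u "a *\<^sub>R v"]
    unfolding norm_add_power2 by linarith
  have "\<mu> * (norm u * norm (a *\<^sub>R v)) \<le> norm G * norm (a *\<^sub>R v)"
    using mult_right_mono[OF G_ge, of "norm (a *\<^sub>R v)"] by simp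
  with mult_left_mono[OF sq, of "\<mu> / 2"] \<open>\<mu> > 0\<close>
  have shift: "- (\<mu> / 2 * (norm (u + a *\<^sub>R v))\<^sup>2)
      \<le> norm G * norm (a *\<^sub>R v) - \<mu> / 2 * (norm u)\<^sup>2 - \<mu> / 2 * (norm (a *\<^sub>R v))\<^sup>2"
    by (simp add: algebra_simps)
  have "(norm G)\<^sup>2 \<le> L\<^sup>2 * (norm u)\<^sup>2"
    using power_mono[OF G_le, of 2] by (simp add: power_mult_distrib)
  then have "(norm G)\<^sup>2 / L\<^sup>2 \<le> (norm u)\<^sup>2"
    using \<open>L > 0\<close> by (simp add: field_simps)
  then have last: "\<mu>\<^sup>2 * sqrt s / 2 * ((norm G)\<^sup>2 / L\<^sup>2) \<le> \<mu>\<^sup>2 * sqrt s / 2 * (norm u)\<^sup>2"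
    using \<open>s > 0\<close> by (intro mult_left_mono) auto
  have powr: "\<mu> powr (3/2) = r * \<mu>"
  proof -
    have "\<mu> powr (3/2) = \<mu> powr (1/2 + 1)" by simp
    also have "\<dots> = r * \<mu>" using \<open>\<mu> > 0\<close> unfolding powr_add by (simp add: powr_half_sqrt r_def)
    finally show ?thesis .
  qed
  have "q * r * (- (g \<bullet> u)) \<le> q * r * (g \<bullet> (a *\<^sub>R v) + f xstar - f y + norm G * norm (a *\<^sub>R v)
      - \<mu> / 2 * (norm u)\<^sup>2 - \<mu> / 2 * (norm (a *\<^sub>R v))\<^sup>2)"
    using at_y shift r qpos by (intro mult_left_mono) auto
  \<comment> \<open>The coefficient 13/16 in \<open>C_ET\<close> arises here: -1 + 1/16 + 1/8 =
    -13/16.\<close>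
  moreover have "r / 16 * (norm (v + (2 * r) *\<^sub>R u))\<^sup>2
      \<le> r / 8 * (norm v)\<^sup>2 + r * \<mu> / 2 * (norm u)\<^sup>2"
    using mult_left_mono[OF young, of "r / 16"] r by (simp add: algebra_simps)
  \<comment> \<open>Strong convexity supplies one full negative gap and \<open>V\<close> costs a
    quarter of it; the remaining 3/4 yields the 3/8 in \<open>C_ET\<close>.\<close>
  moreover have "3/4 * (q * r) * ((norm G)\<^sup>2 / (2 * L)) \<le> 3/4 * (q * r) * (f x - f xstar)"
    using gap r qpos by (intro mult_left_mono) auto
  \<comment> \<open>Splitting \<open>q = 1 + r * sqrt s\<close>: the first part pays for the mixed
    norm exactly, the second is converted by \<open>last\<close>.\<close>
  moreover have "q * r * (\<mu> / 2 * (norm u)\<^sup>2) = r * \<mu> / 2 * (norm u)\<^sup>2 + \<mu>\<^sup>2 * sqrt s / 2 * (norm u)\<^sup>2"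
    by (simp add: q mu power2_eq_square algebra_simps)
  moreover have "C_ET f \<mu> L s (x, v) a =
      - (13 * r / 16) * (norm v)\<^sup>2 - \<mu>\<^sup>2 * sqrt s / 2 * ((norm G)\<^sup>2 / L\<^sup>2)
      - 3/4 * (q * r) * ((norm G)\<^sup>2 / (2 * L)) + q * r * (f x - f y)
      + q * r * (norm G * norm (a *\<^sub>R v)) - q * r * (\<mu> / 2 * (norm (a *\<^sub>R v))\<^sup>2)
      - q * ((g - G) \<bullet> v) + q * r * (g \<bullet> (a *\<^sub>R v))"
    unfolding C_ET.simps Let_def defs G_def[symmetric] powr unfolding y_def[symmetric]
    using \<open>L > 0\<close> by (simp add: field_simps)
  ultimately show ?thesis
    using last
    unfolding G_def[symmetric] distrib_left right_diff_distrib mult_minus_left mult_minus_right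
    by argo
qed

section \<open>Comparison of the two bounds, and the conclusion\<close>

lemma b_ET_le_b_ST:
  fixes f :: "'a::euclidean_space \<Rightarrow> real"
  assumes "\<mu> \<ge> 0" "s \<ge> 0" "t \<ge> 0"
    and diff: "\<And>x. f differentiable (at x)"
    and lip: "L-lipschitz_on UNIV (gradient f)"
  shows "b_ET f \<mu> L s (x, v) t a \<le> b_ST f \<mu> L s (x, v) t a"
proof -
  define r q g where "r = sqrt \<mu>" and "q = sqrt_mus \<mu> s" and "g = gradient f (x + a *\<^sub>R v)"
  have r: "r \<ge> 0" and q: "q \<ge> 0" and mu: "\<mu> = r\<^sup>2"
    using assms by (simp_all add: r_def q_def sqrt_mus_def)
  have "q * ((gradient f (x + t *\<^sub>R v) - gradient f x) \<bullet> v) \<le> q * (L * t * (norm v)\<^sup>2)"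
    using lipschitz_gradient_inner_le[OF lip \<open>t \<ge> 0\<close>] q by (intro mult_left_mono)
  moreover have "f (x + t *\<^sub>R v) - f x \<le> t * (gradient f x \<bullet> v) + L / 2 * t\<^sup>2 * (norm v)\<^sup>2"
    using descent_lemma[OF diff lip, of "x + t *\<^sub>R v" x] by (simp add: power_mult_distrib)
  then have "r * q / 4 * (f (x + t *\<^sub>R v) - f x)
      \<le> r * q / 4 * (t * (gradient f x \<bullet> v) + L / 2 * t\<^sup>2 * (norm v)\<^sup>2)"
    using r q by (intro mult_left_mono) auto
  \<comment> \<open>The bounds differ only where \<open>b_ET\<close> evaluates \<open>f\<close> or
    its gradient at the moving point \<open>x + t *\<^sub>R v\<close>; everything else
    cancels.\<close>
  moreover have "b_ST f \<mu> L s (x, v) t a - b_ET f \<mu> L s (x, v) t a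
      = q * (L * t * (norm v)\<^sup>2) - q * ((gradient f (x + t *\<^sub>R v) - gradient f x) \<bullet> v)
        + r * q / 4 * (t * (gradient f x \<bullet> v) + L / 2 * t\<^sup>2 * (norm v)\<^sup>2)
        - r * q / 4 * (f (x + t *\<^sub>R v) - f x)"
    unfolding b_ST_def b_ET_def C_ST_def A_ET.simps A_ST.simps B_ET.simps Bl_ST.simps Bq_ST.simps
      Let_def r_def[symmetric] q_def[symmetric] g_def[symmetric] inner_diff_left inner_commute[of v g]
    by (simp add: mu power2_eq_square algebra_simps del: C_ET.simps)
  ultimately show ?thesis by linarith
qed

theorem mainTheorem2:
  fixes f :: "real ^ 'n \<Rightarrow> real" and xstar :: "real ^ 'n"
    and \<mu> L s a t :: real and phat :: "(real ^ 'n) \<times> (real ^ 'n)"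
  assumes "\<mu> > 0" and "L > 0" and "s > 0"
    and "continuously_differentiable f"
    and "strongly_convex \<mu> f"
    and "L-lipschitz_on UNIV (gradient f)"
    and "unique_minimizer f xstar"
    and "a \<ge> 0" and "t \<ge> 0"
  shows "(\<lambda>\<tau>. V f xstar \<mu> s (zoh_trajectory f \<mu> s a phat \<tau>)) differentiable (at t)
    \<and> deriv (\<lambda>\<tau>. V f xstar \<mu> s (zoh_trajectory f \<mu> s a phat \<tau>)) t
        + sqrt \<mu> / 4 * V f xstar \<mu> s (zoh_trajectory f \<mu> s a phat t)
        \<le> b_ET f \<mu> L s phat t a
    \<and> b_ET f \<mu> L s phat t a \<le> b_ST f \<mu> L s phat t a"
proof -
  obtain x v where phat: "phat = (x, v)" by force
  have diff: "\<And>x. f differentiable (at x)"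
    using assms(4) by (simp add: continuously_differentiable_def)
  have "f xstar \<le> f y" for y
    using assms(7) by (cases "y = xstar") (auto simp: unique_minimizer_def less_imp_le)
  then have crit: "gradient f xstar = 0"
    by (intro gradient_eq_0_at_minimizer diff)
  note convex = strongly_convex_gradient_ineq[OF assms(5) less_imp_le[OF \<open>\<mu> > 0\<close>]]
  note V' = V_decay_expansion(1)[OF \<open>\<mu> > 0\<close> diff, of xstar s a x v t]
  note V = V_decay_expansion(2)[OF \<open>\<mu> > 0\<close> diff, of xstar s a x v t L]
  have "(norm (gradient f (x + a *\<^sub>R v)))\<^sup>2 / L \<le> gradient f (x + a *\<^sub>R v) \<bullet> (x + a *\<^sub>R v - xstar)"
    using gradient_cocoercive[OF diff assms(6) \<open>L > 0\<close> convex, of "x + a *\<^sub>R v" xstar] crit by simp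
  then have "0 \<le> t * (sqrt \<mu>)\<^sup>2 * sqrt_mus \<mu> s / 4
      * (gradient f (x + a *\<^sub>R v) \<bullet> (x + a *\<^sub>R v - xstar) - (norm (gradient f (x + a *\<^sub>R v)))\<^sup>2 / L)"
    using \<open>\<mu> > 0\<close> \<open>s > 0\<close> \<open>t \<ge> 0\<close> by (simp add: sqrt_mus_def)
  then have "deriv (\<lambda>\<tau>. V f xstar \<mu> s (zoh_trajectory f \<mu> s a (x, v) \<tau>)) t
        + sqrt \<mu> / 4 * V f xstar \<mu> s (zoh_trajectory f \<mu> s a (x, v) t)
        \<le> b_ET f \<mu> L s (x, v) t a"
    using constant_terms_le_C_ET[OF assms(1-3) diff assms(5,6) crit, of x a v]
    unfolding DERIV_imp_deriv[OF V'] V b_ET_def by linarith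
  \<comment> \<open>Differentiability ensures that \<open>deriv\<close> denotes a genuine
    derivative.\<close>
  moreover have "(\<lambda>\<tau>. V f xstar \<mu> s (zoh_trajectory f \<mu> s a (x, v) \<tau>)) differentiable (at t)"
    using V' real_differentiable_def by blast
  moreover have "b_ET f \<mu> L s (x, v) t a \<le> b_ST f \<mu> L s (x, v) t a"
    using assms by (intro b_ET_le_b_ST diff) auto
  ultimately show ?thesis unfolding phat by blast
qed

end
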